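(* Let $(A,\alpha,\mu)$ be a Hom-associative algebra, with $\mu(a\otimes b)=a\cdot b$, and let $(R,S)$ be a Rota-Baxter system on it. Then $(A,\alpha,\prec,\succ)$ is a Hom-dendriform algebra, where $a\prec b=a\cdot S(b)$ and $a\succ b=R(a)\cdot b$ for $a,b\in A$.
   Context: All vector spaces, linear maps and tensor products are over a field $\mathbb{K}$. A (multiplicative) Hom-associative algebra $(A,\alpha,\mu)$ is a vector space $A$ with a linear map $\alpha:A\to A$ and a bilinear map $\mu:A\otimes A\to A$, $a\otimes b\mapsto a\cdot b$, such that $(a\cdot b)\cdot\alpha(c)=\alpha(a)\cdot(b\cdot c)$ and $\alpha(a\cdot b)=\alpha(a)\cdot\alpha(b)$ for all $a,b,c\in A$. All Hom-associative algebras are assumed multiplicative. A Rota-Baxter system on $(A,\alpha,\mu)$ is a pair $(R,S)$ of linear maps $A\to A$ with $\alpha\circ R=R\circ\alpha$, $\alpha\circ S=S\circ\alpha$ and, for all $a,b\in A$, $$R(a)\cdot R(b)=R(R(a)\cdot b+a\cdot S(b)),\qquad S(a)\cdot S(b)=S(R(a)\cdot b+a\cdot S(b)).$$ A Hom-dendriform algebra $(D,\alpha,\prec,\succ)$ is a vector space $D$ with a linear map $\alpha:D\to D$ and bilinear maps $\prec,\succ:D\otimes D\to D$ such that for all $a,b,c\in D$: $\alpha(a\prec b)=\alpha(a)\prec\alpha(b)$, $\alpha(a\succ b)=\alpha(a)\succ\alpha(b)$, and $$(a\prec b)\prec\alpha(c)=\alpha(a)\prec(b\prec c+b\succ c),$$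 $$(a\succ b)\prec\alpha(c)=\alpha(a)\succ(b\prec c),$$ $$(a\prec b+a\succ b)\succ\alpha(c)=\alpha(a)\succ(b\succ c).$$ *)

theory Defs
  imports Complex_Main
begin

text \<open>
  A \<open>K\<close>-vector space is a type \<open>'a\<close> of class \<open>ab_group_add\<close> with a scalar multiplication
  \<open>scale\<close> satisfying \<open>vector_space\<close>; the field is the type \<open>'k\<close>. A linear map
  out of a tensor square is given as the corresponding curried bilinear map.
  \<open>Vector_Spaces.linear\<close> is written qualified because the unqualified name denotes
  real-linear maps.
\<close>

definition (in vector_space) bilinear_op :: "('b \<Rightarrow> 'b \<Rightarrow> 'b) \<Rightarrow> bool" where
  "bilinear_op m \<longleftrightarrow>
     (\<forall>a. Vector_Spaces.linear scale scale (\<lambda>b. m a b)) \<and>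
     (\<forall>b. Vector_Spaces.linear scale scale (\<lambda>a. m a b))"

text \<open>Hom-associative algebras are multiplicative by convention.\<close>

locale hom_associative_algebra = vector_space scale
  for scale :: "'k::field \<Rightarrow> 'a::ab_group_add \<Rightarrow> 'a" +
  fixes \<alpha> :: "'a \<Rightarrow> 'a"
    and mult :: "'a \<Rightarrow> 'a \<Rightarrow> 'a"  (infixl \<open>\<cdot>\<close> 70)
  assumes linear_alpha: "Vector_Spaces.linear scale scale \<alpha>"
    and bilinear_mult: "bilinear_op (\<cdot>)"
    and hom_assoc: "(a \<cdot> b) \<cdot> \<alpha> c = \<alpha> a \<cdot> (b \<cdot> c)"
    and alpha_mult: "\<alpha> (a \<cdot> b) = \<alpha> a \<cdot> \<alpha> b"

locale rota_baxter_system = hom_associative_algebra scale \<alpha> mult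
  for scale :: "'k::field \<Rightarrow> 'a::ab_group_add \<Rightarrow> 'a"
    and \<alpha> :: "'a \<Rightarrow> 'a"
    and mult :: "'a \<Rightarrow> 'a \<Rightarrow> 'a"  (infixl \<open>\<cdot>\<close> 70) +
  fixes R S :: "'a \<Rightarrow> 'a"
  assumes linear_R: "Vector_Spaces.linear scale scale R"
    and linear_S: "Vector_Spaces.linear scale scale S"
    and alpha_R: "\<alpha> \<circ> R = R \<circ> \<alpha>"
    and alpha_S: "\<alpha> \<circ> S = S \<circ> \<alpha>"
    and R_mult: "R a \<cdot> R b = R (R a \<cdot> b + a \<cdot> S b)"
    and S_mult: "S a \<cdot> S b = S (R a \<cdot> b + a \<cdot> S b)"

locale hom_dendriform_algebra = vector_space scale
  for scale :: "'k::field \<Rightarrow> 'a::ab_group_add \<Rightarrow> 'a" +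
  fixes \<alpha> :: "'a \<Rightarrow> 'a"
    and left :: "'a \<Rightarrow> 'a \<Rightarrow> 'a"  (infixl \<open>\<prec>\<close> 70)
    and right :: "'a \<Rightarrow> 'a \<Rightarrow> 'a"  (infixl \<open>\<succ>\<close> 70)
  assumes linear_alpha: "Vector_Spaces.linear scale scale \<alpha>"
    and bilinear_left: "bilinear_op (\<prec>)"
    and bilinear_right: "bilinear_op (\<succ>)"
    and alpha_left: "\<alpha> (a \<prec> b) = \<alpha> a \<prec> \<alpha> b"
    and alpha_right: "\<alpha> (a \<succ> b) = \<alpha> a \<succ> \<alpha> b"
    and dendriform_left: "(a \<prec> b) \<prec> \<alpha> c = \<alpha> a \<prec> (b \<prec> c + b \<succ> c)"
    and dendriform_middle: "(a \<succ> b) \<prec> \<alpha> c = \<alpha> a \<succ> (b \<prec> c)"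
    and dendriform_right: "(a \<prec> b + a \<succ> b) \<succ> \<alpha> c = \<alpha> a \<succ> (b \<succ> c)"

end

theory Submission
  imports Defs
begin

text \<open>Since \<open>R\<close> and \<open>S\<close> commute with \<alpha>, the three dendriform
  identities are Hom-associativity for the triples (a, S b, S c), (R a, b, S c) and (R a, R b, c).
  In the first and last, the Rota-Baxter identities turn \<open>S\<close> or \<open>R\<close> of the
  sum of both products into a single product.\<close>

lemma (in vector_space) bilinear_op_compose:
  assumes "bilinear_op m"
    and "Vector_Spaces.linear scale scale f" and "Vector_Spaces.linear scale scale g"
  shows "bilinear_op (\<lambda>a b. m (f a) (g b))"
  using assms Vector_Spaces.linear_compose[of scale scale f scale]
    Vector_Spaces.linear_compose[of scale scale g scale]
  unfolding bilinear_op_def o_def by blast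

theorem proposition3p5:
  fixes scale :: "'k::field \<Rightarrow> 'a::ab_group_add \<Rightarrow> 'a"
    and \<alpha> :: "'a \<Rightarrow> 'a"
    and mult :: "'a \<Rightarrow> 'a \<Rightarrow> 'a"
    and R S :: "'a \<Rightarrow> 'a"
  assumes "hom_associative_algebra scale \<alpha> mult"
    and "rota_baxter_system scale \<alpha> mult R S"
  shows "hom_dendriform_algebra scale \<alpha> (\<lambda>a b. mult a (S b)) (\<lambda>a b. mult (R a) b)"
proof -
  interpret rota_baxter_system scale \<alpha> mult R S by fact
  \<comment> \<open>Oriented to move \<alpha> outwards, giving the last factor the shape that
    \<open>hom_assoc\<close> matches.\<close>
  have R_alpha: "R (\<alpha> a) = \<alpha> (R a)" and S_alpha: "S (\<alpha> a) = \<alpha> (S a)" for a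
    using alpha_R alpha_S by (simp_all add: fun_eq_iff)
  \<comment> \<open>\<open>R_mult\<close> and \<open>S_mult\<close> reversed, to contract the sum,
    with summands in the dendriform order.\<close>
  have R_sum: "R (mult a (S b) + mult (R a) b) = mult (R a) (R b)"
    and S_sum: "S (mult a (S b) + mult (R a) b) = mult (S a) (S b)" for a b
    by (simp_all add: R_mult S_mult add.commute)
  show ?thesis
  proof (intro hom_dendriform_algebra.intro hom_dendriform_algebra_axioms.intro)
    show "vector_space scale" by (rule vector_space_axioms)
    show "Vector_Spaces.linear scale scale \<alpha>" by (rule linear_alpha)
    show "bilinear_op (\<lambda>a b. mult a (S b))"
      by (rule bilinear_op_compose[OF bilinear_mult linear_ident linear_S])
    show "bilinear_op (\<lambda>a b. mult (R a) b)"
      by (rule bilinear_op_compose[OF bilinear_mult linear_R linear_ident])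
  \<comment> \<open>What remains is multiplicativity of \<alpha> for both products and the three
    identities.\<close>
  qed (simp_all add: R_alpha S_alpha alpha_mult hom_assoc R_sum S_sum)
qed

end
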